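(* There exist infinitely many positive integers $n$ such that there is a (simple) $n$-vertex RAC$_1$ graph with exactly $5n-10$ edges.
   Context: Graphs are simple. A $1$-bend right-angle-crossing drawing (RAC$_1$ drawing) of a graph is a drawing in the plane in which vertices are mapped to distinct points, each edge is drawn as a polygonal curve between its endpoints with at most one bend (and not passing through any other vertex), and whenever two edges cross, they cross at a right angle ($90^\circ$). A graph is a RAC$_1$ graph if it admits a RAC$_1$ drawing. *)

theory Defs
  imports "HOL-Analysis.Analysis"
begin

type_synonym pt = "real \<times> real"

definition simple_graph :: "nat \<Rightarrow> nat set set \<Rightarrow> bool" where
  "simple_graph n E \<longleftrightarrow> E \<subseteq> {{u, v} | u v. u \<noteq> v \<and> u < n \<and> v < n}"

definition perp :: "pt \<Rightarrow> pt \<Rightarrow> bool" where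
  "perp a c \<longleftrightarrow> fst a * fst c + snd a * snd c = 0"

text \<open>Edge e (a 2-set of vertices) drawn with vertex positions p and bend point b e
  as the polygonal curve p u -- b e -- p v.\<close>
definition edge_curve :: "(nat \<Rightarrow> pt) \<Rightarrow> (nat set \<Rightarrow> pt) \<Rightarrow> nat set \<Rightarrow> pt set" where
  "edge_curve p b e = (\<Union>u\<in>e. closed_segment (p u) (b e))"

definition rac1_drawing :: "nat \<Rightarrow> nat set set \<Rightarrow> (nat \<Rightarrow> pt) \<Rightarrow> (nat set \<Rightarrow> pt) \<Rightarrow> bool" where
  "rac1_drawing n E p b \<longleftrightarrow>
     inj_on p {..<n} \<and>
     (\<forall>e\<in>E. \<forall>w<n. w \<notin> e \<longrightarrow> p w \<notin> edge_curve p b e) \<and>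
     (\<forall>e\<in>E. \<forall>u\<in>e. \<forall>v\<in>e. u \<noteq> v \<longrightarrow>
         closed_segment (p u) (b e) \<inter> closed_segment (b e) (p v) = {b e}) \<and>
     (\<forall>e\<in>E. \<forall>f\<in>E. e \<noteq> f \<longrightarrow>
        (\<forall>x \<in> edge_curve p b e \<inter> edge_curve p b f. x \<notin> p ` (e \<inter> f) \<longrightarrow>
           x \<noteq> b e \<and> x \<noteq> b f \<and>
           (\<exists>u\<in>e. \<exists>v\<in>f. x \<in> open_segment (p u) (b e) \<and> x \<in> open_segment (p v) (b f) \<and>
              perp (p u - b e) (p v - b f))))"

definition rac1_graph :: "nat \<Rightarrow> nat set set \<Rightarrow> bool" where
  "rac1_graph n E \<longleftrightarrow> simple_graph n E \<and> (\<exists>p b. rac1_drawing n E p b)"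

end

theory Submission
  imports Defs
begin

text \<open>
  Take a plane graph all of whose faces, the outer one included, are pentagons, and add the five
  diagonals of every face: Euler's formula gives $5n - 10$ edges.  In a pentagonal face let
  $D_i$ be the diagonal around the corner $v_i$, drawn as $v_{i-1}, b_i, v_{i+1}$.
  Only consecutive diagonals need to cross, $D_i$ and $D_{i+1}$ in the legs
  $v_{i+1} b_i$ and $v_i b_{i+1}$, so the drawing is RAC as soon as these legs are orthogonal; in
  a regular pentagon one lets every leg leave its corner at 45 degrees to the side.

  Infinitely many such graphs arise by nesting dodecahedra: a ring of ten faces lies between a
  pentagon and its image under the homothety with ratio $-30$, so a drawing inside the inner pentagon
  can be extended by the ring and shrunk by the factor $-1/30$ to fit into the inner pentagon again.
  The two parts meet only in the corners of the pentagon, so no crossings between them have to be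
  considered, and what remains is a finite computation with the integer coordinates of a single ring.
\<close>


section \<open>Arrangements of arcs with one bend\<close>

text \<open>An arc \<open>(a, b, c)\<close> joins \<open>a\<close> to \<open>c\<close> with a bend at \<open>b\<close>.\<close>

type_synonym 'a arc = "'a \<times> 'a \<times> 'a"

fun ends :: "'a arc \<Rightarrow> 'a set" where
  "ends (a, b, c) = {a, c}"

fun bend :: "'a arc \<Rightarrow> 'a" where
  "bend (a, b, c) = b"

fun map_arc :: "('a \<Rightarrow> 'b) \<Rightarrow> 'a arc \<Rightarrow> 'b arc" where
  "map_arc h (a, b, c) = (h a, h b, h c)"

definition vertices :: "'a arc set \<Rightarrow> 'a set" where
  "vertices D = (\<Union>e\<in>D. ends e)"

definition curve :: "'a::real_vector arc \<Rightarrow> 'a set" where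
  "curve e = (\<Union>a\<in>ends e. closed_segment a (bend e))"

fun proper_arc :: "'a::real_vector arc \<Rightarrow> bool" where
  "proper_arc (a, b, c) \<longleftrightarrow> a \<noteq> b \<and> c \<noteq> b \<and> closed_segment a b \<inter> closed_segment c b = {b}"

definition rac_legs :: "pt \<Rightarrow> pt \<Rightarrow> pt \<Rightarrow> pt \<Rightarrow> bool" where
  "rac_legs a b c d \<longleftrightarrow>
     (\<forall>x \<in> closed_segment a b \<inter> closed_segment c d.
        x = a \<and> x = c \<or> x \<in> open_segment a b \<and> x \<in> open_segment c d \<and> perp (a - b) (c - d))"

definition rac_pair :: "pt arc \<Rightarrow> pt arc \<Rightarrow> bool" where
  "rac_pair e f \<longleftrightarrow>
     ends e \<noteq> ends f \<and> (\<forall>a\<in>ends e. \<forall>c\<in>ends f. rac_legs a (bend e) c (bend f))"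

definition rac_arrangement :: "pt arc set \<Rightarrow> bool" where
  "rac_arrangement D \<longleftrightarrow> (\<forall>e\<in>D. proper_arc e) \<and> pairwise rac_pair D"

lemma ends_map_arc [simp]: "ends (map_arc h e) = h ` ends e"
  by (cases e) simp

lemma bend_map_arc [simp]: "bend (map_arc h e) = h (bend e)"
  by (cases e) simp

lemma inj_map_arc: "inj h \<Longrightarrow> inj (map_arc h)"
  by (auto intro!: injI dest: injD elim!: map_arc.elims)

lemma finite_vertices: "finite D \<Longrightarrow> finite (vertices D)"
  by (auto simp: vertices_def)

lemma vertices_Un: "vertices (D \<union> D') = vertices D \<union> vertices D'"
  by (simp add: vertices_def)

lemma vertices_map_arc: "vertices (map_arc h ` D) = h ` vertices D"
  by (simp add: vertices_def image_UN)

lemma curve_arc: "curve (a, b, c) = closed_segment a b \<union> closed_segment c b"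
  by (simp add: curve_def)

lemma curve_map_arc: "linear h \<Longrightarrow> curve (map_arc h e) = h ` curve e"
  by (simp add: curve_def closed_segment_linear_image image_UN)

lemma ends_subset_curve: "ends e \<subseteq> curve e"
  by (auto simp: curve_def)

lemma vertices_subset_curves: "vertices D \<subseteq> (\<Union>e\<in>D. curve e)"
  using ends_subset_curve unfolding vertices_def by blast

lemma proper_arc_ends_neq: "proper_arc (a, b, c) \<Longrightarrow> a \<noteq> c"
  by auto

lemma proper_arc_inter_legs:
  assumes "proper_arc e" "a \<in> ends e" "c \<in> ends e" "a \<noteq> c"
  shows "closed_segment a (bend e) \<inter> closed_segment c (bend e) = {bend e}"
proof -
  obtain s b t where e_eq: "e = (s, b, t)" by (cases e)
  have "a = s \<and> c = t \<or> a = t \<and> c = s" using assms(2-4) unfolding e_eq by auto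
  then show ?thesis using assms(1) unfolding e_eq by (elim disjE conjE) (simp_all add: Int_commute)
qed

lemma proper_arc_end_on_leg:
  assumes "proper_arc e" and "x \<in> ends e" and "a \<in> ends e" and "x \<in> closed_segment a (bend e)"
  shows "x = a"
proof (rule ccontr)
  assume "x \<noteq> a"
  then have "x = bend e" using proper_arc_inter_legs[OF assms(1-3)] assms(4) by auto
  then show False using assms(1,2) by (cases e) auto
qed

lemma perp_iff_inner: "perp u v \<longleftrightarrow> u \<bullet> v = 0"
  by (simp add: perp_def inner_prod_def)

lemma rac_legs_commute: "rac_legs a b c d \<longleftrightarrow> rac_legs c d a b"
  unfolding rac_legs_def perp_iff_inner by (auto simp: inner_commute)

lemma rac_legs_end_on_leg:
  assumes "rac_legs a b c d" and "a \<in> closed_segment c d"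
  shows "a = c"
  using assms unfolding rac_legs_def open_segment_def by auto

lemma rac_pair_commute: "rac_pair e f \<longleftrightarrow> rac_pair f e"
  unfolding rac_pair_def using rac_legs_commute by blast

lemma sorted_wrt_rac_pair:
  assumes "sorted_wrt rac_pair es"
  shows "distinct es" "pairwise rac_pair (set es)"
proof -
  have "\<not> rac_pair e e" for e by (simp add: rac_pair_def)
  with assms show "distinct es" by (induction es) auto
  from assms show "pairwise rac_pair (set es)"
    by (induction es) (simp_all add: pairwise_insert rac_pair_commute)
qed

lemma rac_arrangement_pair:
  "rac_arrangement D \<Longrightarrow> e \<in> D \<Longrightarrow> f \<in> D \<Longrightarrow> e \<noteq> f \<Longrightarrow> rac_pair e f"
  by (simp add: rac_arrangement_def pairwise_def)

lemma rac_arrangement_vertex_on_curve: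
  assumes "rac_arrangement D" and "e \<in> D" and "v \<in> vertices D" and "v \<in> curve e"
  shows "v \<in> ends e"
proof -
  obtain f where f: "f \<in> D" "v \<in> ends f" using assms(3) by (auto simp: vertices_def)
  obtain a where a: "a \<in> ends e" "v \<in> closed_segment a (bend e)"
    using assms(4) by (auto simp: curve_def)
  show ?thesis
  proof (cases "f = e")
    case False
    then have "rac_legs v (bend f) a (bend e)"
      using rac_arrangement_pair[OF assms(1) f(1) assms(2)] f(2) a(1) by (simp add: rac_pair_def)
    then show ?thesis using rac_legs_end_on_leg a by blast
  qed (use f in simp)
qed

lemma rac_arrangement_crossing:
  assumes "rac_arrangement D" and "e \<in> D" "f \<in> D" "e \<noteq> f"
    and x_in: "x \<in> curve e \<inter> curve f" and x_notin: "x \<notin> ends e \<inter> ends f"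
  shows "x \<noteq> bend e \<and> x \<noteq> bend f \<and>
    (\<exists>a\<in>ends e. \<exists>c\<in>ends f. x \<in> open_segment a (bend e) \<and> x \<in> open_segment c (bend f) \<and>
       perp (a - bend e) (c - bend f))"
proof -
  obtain a c where ac: "a \<in> ends e" "c \<in> ends f"
      "x \<in> closed_segment a (bend e) \<inter> closed_segment c (bend f)"
    using x_in by (auto simp: curve_def)
  have "rac_legs a (bend e) c (bend f)"
    using rac_arrangement_pair[OF assms(1-4)] ac(1,2) by (simp add: rac_pair_def)
  moreover have "\<not> (x = a \<and> x = c)" using x_notin ac(1,2) by blast
  ultimately have "x \<in> open_segment a (bend e)" "x \<in> open_segment c (bend f)"
      "perp (a - bend e) (c - bend f)"
    using ac(3) unfolding rac_legs_def by blast+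
  then show ?thesis using ac(1,2) by (auto simp: open_segment_def)
qed

lemma rac_pair_if_curves_meet_in_ends:
  assumes "proper_arc e" "proper_arc f" "ends e \<noteq> ends f" "curve e \<inter> curve f \<subseteq> ends e \<inter> ends f"
  shows "rac_pair e f"
  unfolding rac_pair_def rac_legs_def
proof (intro conjI ballI disjI1)
  fix a c x
  assume ac: "a \<in> ends e" "c \<in> ends f"
    and x_in: "x \<in> closed_segment a (bend e) \<inter> closed_segment c (bend f)"
  then have "x \<in> ends e" "x \<in> ends f" using assms(4) by (auto simp: curve_def)
  then show "x = a" "x = c" using proper_arc_end_on_leg assms(1,2) ac x_in by blast+
qed (rule assms(3))

lemma rac_arrangement_Un:
  assumes rac: "rac_arrangement D" "rac_arrangement D'"
    and meet: "(\<Union>e\<in>D. curve e) \<inter> (\<Union>f\<in>D'. curve f) \<subseteq> vertices D \<inter> vertices D'"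
    and ends: "\<And>e f. e \<in> D \<Longrightarrow> f \<in> D' \<Longrightarrow> ends e \<noteq> ends f"
  shows "rac_arrangement (D \<union> D')"
proof -
  have between: "rac_pair e f" if ef: "e \<in> D" "f \<in> D'" for e f
  proof (rule rac_pair_if_curves_meet_in_ends)
    show "proper_arc e" "proper_arc f" using rac ef by (auto simp: rac_arrangement_def)
    show "ends e \<noteq> ends f" using ends ef .
    have "curve e \<inter> curve f \<subseteq> vertices D \<inter> vertices D'" using meet ef by blast
    then show "curve e \<inter> curve f \<subseteq> ends e \<inter> ends f"
      using rac_arrangement_vertex_on_curve[OF rac(1) ef(1)]
        rac_arrangement_vertex_on_curve[OF rac(2) ef(2)] by blast
  qed
  have "pairwise rac_pair (D \<union> D')"
  proof (rule pairwiseI)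
    fix e f assume "e \<in> D \<union> D'" "f \<in> D \<union> D'" "e \<noteq> f"
    then consider "e \<in> D" "f \<in> D" | "e \<in> D'" "f \<in> D'" | "e \<in> D" "f \<in> D'" | "f \<in> D" "e \<in> D'"
      by blast
    then show "rac_pair e f"
      using rac_arrangement_pair[OF rac(1) _ _ \<open>e \<noteq> f\<close>] rac_arrangement_pair[OF rac(2) _ _ \<open>e \<noteq> f\<close>]
        between[of e f] between[of f e, THEN rac_pair_commute[THEN iffD1]]
      by cases
  qed
  then show ?thesis using rac unfolding rac_arrangement_def by blast
qed

lemma rac_arrangement_map_arc:
  assumes lin: "linear h" and inj: "inj h" and perp: "\<And>u v. perp u v \<Longrightarrow> perp (h u) (h v)"
    and rac: "rac_arrangement D"
  shows "rac_arrangement (map_arc h ` D)"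
proof -
  note segment = closed_segment_linear_image[OF lin] open_segment_linear_image[OF lin inj]
  have proper: "proper_arc (map_arc h e)" if "proper_arc e" for e
  proof -
    obtain a b c where e_eq: "e = (a, b, c)" by (cases e)
    have "closed_segment (h a) (h b) \<inter> closed_segment (h c) (h b) =
        h ` (closed_segment a b \<inter> closed_segment c b)"
      by (simp only: segment image_Int[OF inj])
    then show ?thesis
      using that inj_eq[OF inj] unfolding e_eq map_arc.simps proper_arc.simps by simp
  qed
  have "rac_legs (h a) (h b) (h c) (h d)" if "rac_legs a b c d" for a b c d
    unfolding rac_legs_def segment image_Int[OF inj, symmetric] linear_diff[OF lin, symmetric]
      ball_simps(9) inj_image_mem_iff[OF inj] inj_eq[OF inj]
    using that perp unfolding rac_legs_def by blast
  then have pair: "rac_pair (map_arc h e) (map_arc h f)" if "rac_pair e f" for e f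
    using that unfolding rac_pair_def ends_map_arc bend_map_arc ball_simps(9) inj_image_eq_iff[OF inj]
    by blast
  have "pairwise rac_pair (map_arc h ` D)"
    unfolding pairwise_image
    by (rule pairwise_mono[of rac_pair D]) (use rac pair in \<open>simp_all add: rac_arrangement_def\<close>)
  then show ?thesis using rac proper by (simp add: rac_arrangement_def)
qed

lemma edge_curve_eq_curve:
  assumes "ends e = p ` u" "bend e = b u"
  shows "edge_curve p b u = curve e"
  by (simp add: edge_curve_def curve_def assms)

lemma rac1_drawing_if_rac_arrangement:
  assumes rac: "rac_arrangement D" and bij: "bij_betw p {..<n} (vertices D)"
    and edge: "\<And>e. e \<in> D \<Longrightarrow> edge e \<subseteq> {..<n}" "\<And>e. e \<in> D \<Longrightarrow> ends e = p ` edge e"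
    and bend: "\<And>e. e \<in> D \<Longrightarrow> bend e = b (edge e)"
  shows "rac1_drawing n (edge ` D) p b"
proof -
  have inj: "inj_on p {..<n}" using bij by (rule bij_betw_imp_inj_on)
  have curve: "edge_curve p b (edge e) = curve e" if "e \<in> D" for e
    using edge(2)[OF that] bend[OF that] by (rule edge_curve_eq_curve)
  have vertex: "p w \<notin> edge_curve p b (edge e)" if "e \<in> D" "w < n" "w \<notin> edge e" for e w
  proof -
    have "p w \<in> vertices D" using bij \<open>w < n\<close> by (auto dest: bij_betwE)
    moreover have "p w \<notin> ends e"
      using inj edge[OF \<open>e \<in> D\<close>] that(2,3) by (simp add: inj_on_image_mem_iff)
    ultimately show ?thesis
      using rac_arrangement_vertex_on_curve[OF rac \<open>e \<in> D\<close>] curve[OF \<open>e \<in> D\<close>] by blast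
  qed
  have legs: "closed_segment (p u) (b (edge e)) \<inter> closed_segment (b (edge e)) (p v) = {b (edge e)}"
    if "e \<in> D" "u \<in> edge e" "v \<in> edge e" "u \<noteq> v" for e u v
    unfolding bend[OF \<open>e \<in> D\<close>, symmetric] closed_segment_commute[of "bend e"]
  proof (rule proper_arc_inter_legs)
    show "proper_arc e" using rac \<open>e \<in> D\<close> by (simp add: rac_arrangement_def)
    show "p u \<in> ends e" "p v \<in> ends e" using edge(2)[OF \<open>e \<in> D\<close>] that(2,3) by blast+
    show "p u \<noteq> p v" using that inj_on_eq_iff[OF inj] edge(1)[OF \<open>e \<in> D\<close>] by blast
  qed
  have crossing: "x \<noteq> b (edge e) \<and> x \<noteq> b (edge f) \<and>
      (\<exists>u\<in>edge e. \<exists>v\<in>edge f. x \<in> open_segment (p u) (b (edge e)) \<and>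
        x \<in> open_segment (p v) (b (edge f)) \<and> perp (p u - b (edge e)) (p v - b (edge f)))"
    if "e \<in> D" "f \<in> D" "edge e \<noteq> edge f"
      "x \<in> edge_curve p b (edge e) \<inter> edge_curve p b (edge f)" "x \<notin> p ` (edge e \<inter> edge f)" for e f x
    using rac_arrangement_crossing[OF rac that(1,2), of x] that(3-5)
      inj_on_image_Int[OF inj edge(1)[OF that(1)] edge(1)[OF that(2)]]
    unfolding curve[OF that(1)] curve[OF that(2)]
      edge(2)[OF that(1)] edge(2)[OF that(2)] bend[OF that(1)] bend[OF that(2)] bex_simps(7) by blast
  show ?thesis
    unfolding rac1_drawing_def ball_simps(9)
  proof (intro conjI ballI allI)
    show "inj_on p {..<n}" by (rule inj)
  qed (intro impI ballI; rule vertex legs crossing; assumption)+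
qed

lemma rac1_graph_if_rac_arrangement:
  assumes "finite D" and rac: "rac_arrangement D"
  shows "\<exists>E. rac1_graph (card (vertices D)) E \<and> card E = card D"
proof -
  let ?n = "card (vertices D)"
  obtain p where bij: "bij_betw p {..<?n} (vertices D)"
    using ex_bij_betw_nat_finite[OF finite_vertices[OF assms(1)]] by (auto simp: atLeast0LessThan)
  define edge where "edge e = inv_into {..<?n} p ` ends e" for e
  have ends: "ends e \<subseteq> vertices D" if "e \<in> D" for e
    using that by (auto simp: vertices_def)
  have edge: "edge e \<subseteq> {..<?n}" "ends e = p ` edge e" if "e \<in> D" for e
    using ends[OF that] bij_betwE[OF bij_betw_inv_into[OF bij]] bij_betw_imp_surj_on[OF bij]
    by (auto simp: edge_def image_inv_into_cancel)
  have inj: "inj_on edge D"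
  proof (rule inj_onI)
    fix e f assume ef: "e \<in> D" "f \<in> D" "edge e = edge f"
    then have "ends e = ends f" using edge(2) by metis
    then show "e = f" using rac_arrangement_pair[OF rac ef(1,2)] by (auto simp: rac_pair_def)
  qed
  have "simple_graph ?n (edge ` D)"
    unfolding simple_graph_def
  proof (rule image_subsetI)
    fix e assume "e \<in> D"
    obtain a b c where e_eq: "e = (a, b, c)" by (cases e)
    let ?u = "inv_into {..<?n} p a" and ?v = "inv_into {..<?n} p c"
    have "edge e = {?u, ?v}" by (simp add: edge_def e_eq)
    moreover have "a \<noteq> c"
      using rac \<open>e \<in> D\<close> unfolding rac_arrangement_def e_eq by (intro proper_arc_ends_neq) blast
    ultimately have "edge e = {?u, ?v}" "?u \<noteq> ?v" "?u < ?n" "?v < ?n"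
      using edge[OF \<open>e \<in> D\<close>] unfolding e_eq by auto
    then show "edge e \<in> {{u, v} |u v. u \<noteq> v \<and> u < ?n \<and> v < ?n}" by blast
  qed
  moreover have "rac1_drawing ?n (edge ` D) p (bend \<circ> inv_into D edge)"
    using rac bij edge by (rule rac1_drawing_if_rac_arrangement) (simp_all add: inj)
  ultimately show ?thesis
    using card_image[OF inj] unfolding rac1_graph_def by blast
qed


section \<open>Orientation of triples of points\<close>

definition orient :: "'a::comm_ring \<times> 'a \<Rightarrow> 'a \<times> 'a \<Rightarrow> 'a \<times> 'a \<Rightarrow> 'a" where
  "orient a b c = (fst b - fst a) * (snd c - snd a) - (snd b - snd a) * (fst c - fst a)"

definition dot :: "'a::comm_ring \<times> 'a \<Rightarrow> 'a \<times> 'a \<Rightarrow> 'a" where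
  "dot u v = fst u * fst v + snd u * snd v"

definition same_side :: "'a::linordered_idom \<times> 'a \<Rightarrow> 'a \<times> 'a \<Rightarrow> 'a \<times> 'a \<Rightarrow> 'a \<times> 'a \<Rightarrow> bool" where
  "same_side a b c d \<longleftrightarrow> sgn (orient a b c) * sgn (orient a b d) = 1"

lemma orient_self [simp]: "orient a a b = 0" "orient a b a = 0" "orient a b b = 0"
  by (simp_all add: orient_def mult.commute)

lemma orient_swap: "orient b a c = - orient a b c"
  by (simp add: orient_def algebra_simps)

lemma orient_affine:
  fixes a b c d :: pt
  shows "orient a b ((1 - t) *\<^sub>R c + t *\<^sub>R d) = (1 - t) * orient a b c + t * orient a b d"
  by (simp add: orient_def algebra_simps)

lemma orient_scaleR:
  fixes a b c :: pt
  shows "orient (r *\<^sub>R a) (r *\<^sub>R b) (r *\<^sub>R c) = r\<^sup>2 * orient a b c"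
  by (simp add: orient_def power2_eq_square algebra_simps)

lemma orient_closed_segment:
  fixes a b :: pt
  shows "x \<in> closed_segment a b \<Longrightarrow> orient a b x = 0"
  by (auto simp: in_segment orient_affine)

lemma dot_eq_inner:
  fixes u v :: pt
  shows "dot u v = u \<bullet> v"
  by (simp add: dot_def inner_prod_def)

lemma segments_disjoint_if_same_side:
  fixes a b c d :: pt
  assumes "same_side a b c d"
  shows "closed_segment a b \<inter> closed_segment c d = {}"
proof (rule ccontr)
  assume "\<not> ?thesis"
  then obtain x where x_in: "x \<in> closed_segment a b" "x \<in> closed_segment c d" by blast
  then obtain t where t: "0 \<le> t" "t \<le> 1" "x = (1 - t) *\<^sub>R c + t *\<^sub>R d"
    by (auto simp: in_segment)
  let ?C = "orient a b c" and ?D = "orient a b d"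
  have pos: "0 < ?C * ?D"
    using assms by (simp add: same_side_def sgn_1_pos flip: sgn_mult)
  have "(1 - t) * (?C * ?C) + t * (?C * ?D) = ?C * orient a b x"
    unfolding t(3) orient_affine by (simp add: algebra_simps)
  then have "(1 - t) * (?C * ?C) = 0" "t * (?C * ?D) = 0"
    using orient_closed_segment[OF x_in(1)] t(1,2) pos by (simp_all add: add_nonneg_eq_0_iff)
  then show False using pos by auto
qed

lemma segments_common_endpoint:
  fixes a b d :: pt
  assumes "orient a b d \<noteq> 0" and "x \<in> closed_segment a b" and "x \<in> closed_segment a d"
  shows "x = a"
proof -
  obtain t where t: "x = (1 - t) *\<^sub>R a + t *\<^sub>R d"
    using assms(3) by (auto simp: in_segment)
  have "t * orient a b d = 0"
    using orient_closed_segment[OF assms(2)] unfolding t orient_affine by simp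
  then show ?thesis using assms(1) t by simp
qed

lemma segments_obtuse_angle:
  fixes a b c :: "'a::real_inner"
  assumes "(a - b) \<bullet> (c - b) < 0" and "x \<in> closed_segment a b" and "x \<in> closed_segment c b"
  shows "x = b"
proof -
  obtain s where s: "0 \<le> s" "x - b = s *\<^sub>R (a - b)"
    using assms(2) unfolding closed_segment_commute[of a b] by (auto simp: in_segment algebra_simps)
  obtain t where t: "0 \<le> t" "x - b = t *\<^sub>R (c - b)"
    using assms(3) unfolding closed_segment_commute[of c b] by (auto simp: in_segment algebra_simps)
  have "(x - b) \<bullet> (x - b) = (s * t) * ((a - b) \<bullet> (c - b))"
    by (subst (1) s(2), subst t(2)) simp
  also have "\<dots> \<le> 0" using s(1) t(1) assms(1) by (simp add: mult_nonneg_nonpos)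
  finally have "(x - b) \<bullet> (x - b) = 0" by (intro antisym inner_ge_zero)
  then show ?thesis by simp
qed


section \<open>Computable criteria for legs and arcs\<close>

text \<open>The conditionals, unlike disjunctions, are evaluated lazily by the simplifier.\<close>

definition rac_legs_test ::
  "'a::linordered_idom \<times> 'a \<Rightarrow> 'a \<times> 'a \<Rightarrow> 'a \<times> 'a \<Rightarrow> 'a \<times> 'a \<Rightarrow> bool" where
  "rac_legs_test a b c d =
     (if same_side a b c d then True
      else if same_side c d a b then True
      else if a = c then orient a b d \<noteq> 0
      else orient a b c \<noteq> 0 \<and> orient a b d \<noteq> 0 \<and> orient c d a \<noteq> 0 \<and> orient c d b \<noteq> 0 \<and>
        dot (a - b) (c - d) = 0)"

fun proper_arc_test :: "('a::linordered_idom \<times> 'a) arc \<Rightarrow> bool" where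
  "proper_arc_test (a, b, c) \<longleftrightarrow> orient a b c \<noteq> 0 \<or> dot (a - b) (c - b) < 0"

fun rac_pair_test :: "('a::linordered_idom \<times> 'a) arc \<Rightarrow> ('a \<times> 'a) arc \<Rightarrow> bool" where
  "rac_pair_test (a, b, c) (a', b', c') \<longleftrightarrow>
     (a, c) \<noteq> (a', c') \<and> (a, c) \<noteq> (c', a') \<and>
     rac_legs_test a b a' b' \<and> rac_legs_test a b c' b' \<and>
     rac_legs_test c b a' b' \<and> rac_legs_test c b c' b'"

lemma rac_legs_if_test:
  assumes "rac_legs_test a b c d"
  shows "rac_legs a b c d"
  unfolding rac_legs_def
proof
  fix x assume x_in: "x \<in> closed_segment a b \<inter> closed_segment c d"
  then have "\<not> same_side a b c d" "\<not> same_side c d a b"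
    using segments_disjoint_if_same_side by blast+
  then have test: "if a = c then orient a b d \<noteq> 0
      else orient a b c \<noteq> 0 \<and> orient a b d \<noteq> 0 \<and> orient c d a \<noteq> 0 \<and> orient c d b \<noteq> 0 \<and>
        dot (a - b) (c - d) = 0"
    using assms by (simp only: rac_legs_test_def if_False)
  show "x = a \<and> x = c \<or> x \<in> open_segment a b \<and> x \<in> open_segment c d \<and> perp (a - b) (c - d)"
  proof (cases "a = c")
    case True
    then show ?thesis using test x_in segments_common_endpoint[of a b d x] by simp
  next
    case False
    have "orient a b x = 0" "orient c d x = 0" using x_in orient_closed_segment by blast+
    then have "x \<noteq> a" "x \<noteq> b" "x \<noteq> c" "x \<noteq> d" using test False by auto
    then show ?thesis
      using test False x_in by (simp add: open_segment_def perp_iff_inner dot_eq_inner)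
  qed
qed

lemma proper_arc_if_test:
  fixes e :: "pt arc"
  assumes "proper_arc_test e"
  shows "proper_arc e"
proof -
  obtain a b c where e_eq: "e = (a, b, c)" by (cases e)
  have test: "orient b a c \<noteq> 0 \<or> (a - b) \<bullet> (c - b) < 0"
    using assms unfolding e_eq by (simp add: dot_eq_inner orient_swap[of b])
  have "x = b" if "x \<in> closed_segment a b" "x \<in> closed_segment c b" for x
    using test that segments_common_endpoint[of b a c x] segments_obtuse_angle[of a b c x]
    by (auto simp: closed_segment_commute[of b])
  moreover have "a \<noteq> b" "c \<noteq> b" using test by auto
  ultimately show ?thesis unfolding e_eq by auto
qed

lemma rac_pair_if_test:
  assumes "rac_pair_test e f"
  shows "rac_pair e f"
proof -
  obtain a b c a' b' c' where "e = (a, b, c)" "f = (a', b', c')" by (cases e; cases f)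
  then show ?thesis
    using assms by (auto simp: rac_pair_def doubleton_eq_iff rac_legs_if_test)
qed


section \<open>Arrangements inside and around a polygon\<close>

text \<open>A convex polygon is given by its sides, directed counterclockwise.\<close>

definition open_polygon :: "(pt \<times> pt) set \<Rightarrow> pt set" where
  "open_polygon W = {z. \<forall>(p, q)\<in>W. 0 < orient p q z}"

abbreviation corners :: "('a \<times> 'a) set \<Rightarrow> 'a set" where
  "corners W \<equiv> fst ` W"

definition drawn_inside :: "(pt \<times> pt) set \<Rightarrow> pt arc set \<Rightarrow> bool" where
  "drawn_inside W D \<longleftrightarrow> finite D \<and> rac_arrangement D \<and> corners W \<subseteq> vertices D \<and>
     (\<forall>e\<in>D. curve e \<subseteq> open_polygon W \<union> corners W \<and> \<not> ends e \<subseteq> corners W)"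

definition drawn_around :: "(pt \<times> pt) set \<Rightarrow> pt arc set \<Rightarrow> bool" where
  "drawn_around W D \<longleftrightarrow> finite D \<and> rac_arrangement D \<and> corners W \<subseteq> vertices D \<and>
     (\<forall>e\<in>D. curve e \<inter> open_polygon W = {})"

lemma corners_Int_open_polygon: "corners W \<inter> open_polygon W = {}"
  by (force simp: open_polygon_def)

lemma closed_segment_into_open_polygon:
  assumes "\<And>p q. (p, q) \<in> W \<Longrightarrow> 0 \<le> orient p q a" and "b \<in> open_polygon W"
    and "x \<in> closed_segment a b" "x \<noteq> a"
  shows "x \<in> open_polygon W"
proof -
  obtain t where t: "0 \<le> t" "t \<le> 1" "x = (1 - t) *\<^sub>R a + t *\<^sub>R b"
    using assms(3) by (auto simp: in_segment)
  have "0 < t" using t \<open>x \<noteq> a\<close> by (cases "t = 0") auto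
  have "0 < orient p q x" if "(p, q) \<in> W" for p q
  proof -
    have "0 \<le> (1 - t) * orient p q a" using assms(1)[OF that] t(2) by simp
    moreover have "0 < t * orient p q b"
      using assms(2) that \<open>0 < t\<close> by (auto simp: open_polygon_def)
    ultimately show ?thesis unfolding t(3) orient_affine by linarith
  qed
  then show ?thesis by (auto simp: open_polygon_def)
qed

lemma closed_segment_outside_open_polygon:
  assumes "(p, q) \<in> W" "orient p q a \<le> 0" "orient p q b \<le> 0" "x \<in> closed_segment a b"
  shows "x \<notin> open_polygon W"
proof -
  obtain t where t: "0 \<le> t" "t \<le> 1" "x = (1 - t) *\<^sub>R a + t *\<^sub>R b"
    using assms(4) by (auto simp: in_segment)
  have "(1 - t) * orient p q a \<le> 0" "t * orient p q b \<le> 0"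
    using assms(2,3) t(1,2) by (simp_all add: mult_nonneg_nonpos)
  then have "orient p q x \<le> 0" unfolding t(3) orient_affine by linarith
  then show ?thesis using assms(1) by (force simp: open_polygon_def)
qed

lemma drawn_inside_corners: "drawn_inside W D \<Longrightarrow> corners W \<subseteq> vertices D"
  by (simp add: drawn_inside_def)

lemma drawn_around_corners: "drawn_around W R \<Longrightarrow> corners W \<subseteq> vertices R"
  by (simp add: drawn_around_def)

lemma drawn_inside_curve: "drawn_inside W D \<Longrightarrow> e \<in> D \<Longrightarrow> curve e \<subseteq> open_polygon W \<union> corners W"
  by (simp add: drawn_inside_def)

lemma drawn_around_curve: "drawn_around W R \<Longrightarrow> e \<in> R \<Longrightarrow> curve e \<inter> open_polygon W = {}"
  by (simp add: drawn_around_def)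

lemma inside_around_ends_neq:
  assumes "drawn_inside W D" "drawn_around W R" "e \<in> D" "f \<in> R"
  shows "ends e \<noteq> ends f"
proof
  assume "ends e = ends f"
  then have "ends e \<subseteq> curve e \<inter> curve f"
    using ends_subset_curve[of e] ends_subset_curve[of f] by blast
  moreover have "\<not> ends e \<subseteq> corners W" using assms(1,3) by (simp add: drawn_inside_def)
  ultimately show False
    using drawn_inside_curve[OF assms(1,3)] drawn_around_curve[OF assms(2,4)] by blast
qed

lemma inside_around_curves_Int:
  assumes "drawn_inside W D" "drawn_around W R"
  shows "(\<Union>e\<in>D. curve e) \<inter> (\<Union>f\<in>R. curve f) \<subseteq> corners W"
  using drawn_inside_curve[OF assms(1)] drawn_around_curve[OF assms(2)] by blast

lemma rac_arrangement_inside_Un_around: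
  assumes inside: "drawn_inside W D" and around: "drawn_around W R"
  shows "rac_arrangement (D \<union> R)"
proof (rule rac_arrangement_Un)
  show "(\<Union>e\<in>D. curve e) \<inter> (\<Union>f\<in>R. curve f) \<subseteq> vertices D \<inter> vertices R"
    using inside_around_curves_Int[OF assms] drawn_inside_corners[OF inside] drawn_around_corners[OF around]
    by blast
  show "ends e \<noteq> ends f" if "e \<in> D" "f \<in> R" for e f
    using inside_around_ends_neq[OF assms that] .
qed (use assms in \<open>simp_all add: drawn_inside_def drawn_around_def\<close>)

lemma card_inside_Un_around:
  assumes inside: "drawn_inside W D" and around: "drawn_around W R"
  shows "card (D \<union> R) = card D + card R"
    and "card (vertices (D \<union> R)) + card (corners W) = card (vertices D) + card (vertices R)"
proof -
  have finite: "finite D" "finite R" using assms by (simp_all add: drawn_inside_def drawn_around_def)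
  have "D \<inter> R = {}" using inside_around_ends_neq[OF assms] by fast
  with finite show "card (D \<union> R) = card D + card R" by (rule card_Un_disjoint)
  have "vertices D \<inter> vertices R = corners W"
  proof
    show "vertices D \<inter> vertices R \<subseteq> corners W"
      using Int_mono[OF vertices_subset_curves vertices_subset_curves] inside_around_curves_Int[OF assms]
      by (rule subset_trans)
    show "corners W \<subseteq> vertices D \<inter> vertices R"
      using drawn_inside_corners[OF inside] drawn_around_corners[OF around] by (rule Int_greatest)
  qed
  then show "card (vertices (D \<union> R)) + card (corners W) = card (vertices D) + card (vertices R)"
    using card_Un_Int[of "vertices D" "vertices R"] finite by (simp add: vertices_Un finite_vertices)
qed

lemma drawn_inside_Un:
  assumes inside: "drawn_inside W D" and ring: "drawn_around W R" "drawn_inside W' R"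
    and nested: "open_polygon W \<union> corners W \<subseteq> open_polygon W'"
  shows "drawn_inside W' (D \<union> R)"
  unfolding drawn_inside_def
proof (intro conjI ballI)
  show "rac_arrangement (D \<union> R)" using inside ring(1) by (rule rac_arrangement_inside_Un_around)
  show "finite (D \<union> R)" "corners W' \<subseteq> vertices (D \<union> R)"
    using inside ring by (auto simp: drawn_inside_def vertices_Un)
  fix e assume "e \<in> D \<union> R"
  then consider "e \<in> D" | "e \<in> R" by blast
  then have "curve e \<subseteq> open_polygon W' \<union> corners W' \<and> \<not> ends e \<subseteq> corners W'"
  proof cases
    assume "e \<in> D"
    then have "curve e \<subseteq> open_polygon W'" using drawn_inside_curve[OF inside] nested by blast
    moreover have "ends e \<noteq> {}" by (cases e) simp
    ultimately show ?thesis using ends_subset_curve[of e] corners_Int_open_polygon[of W'] by blast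
  qed (use ring(2) in \<open>simp add: drawn_inside_def\<close>)
  then show "curve e \<subseteq> open_polygon W' \<union> corners W'" "\<not> ends e \<subseteq> corners W'" by blast+
qed

lemma drawn_inside_scaleR:
  assumes "r \<noteq> 0" and "drawn_inside W D"
  shows "drawn_inside (map_prod ((*\<^sub>R) r) ((*\<^sub>R) r) ` W) (map_arc ((*\<^sub>R) r) ` D)"
proof -
  let ?h = "(*\<^sub>R) r :: pt \<Rightarrow> pt"
  have lin: "linear ?h" and inj: "inj ?h"
    using assms(1) by (simp_all add: linear_scaleR injective_scaleR)
  have "rac_arrangement (map_arc ?h ` D)"
    using assms(2) by (intro rac_arrangement_map_arc lin inj) (simp_all add: drawn_inside_def perp_iff_inner)
  moreover have corners: "corners (map_prod ?h ?h ` W) = ?h ` corners W"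
    by (simp add: image_image)
  moreover have "?h ` open_polygon W \<subseteq> open_polygon (map_prod ?h ?h ` W)"
    using assms(1)
    by (intro image_subsetI) (simp add: open_polygon_def case_prod_unfold orient_scaleR)
  ultimately show ?thesis
    using assms(2) unfolding drawn_inside_def corners
    by (simp add: vertices_map_arc image_mono curve_map_arc[OF lin] inj_image_subset_iff[OF inj]) blast
qed


section \<open>Drawings with integer coordinates\<close>

type_synonym ipt = "int \<times> int"

definition real_pt :: "ipt \<Rightarrow> pt" where
  "real_pt = map_prod of_int of_int"

definition real_arcs :: "ipt arc list \<Rightarrow> pt arc set" where
  "real_arcs es = map_arc real_pt ` set es"

definition real_sides :: "(ipt \<times> ipt) list \<Rightarrow> (pt \<times> pt) set" where
  "real_sides W = map_prod real_pt real_pt ` set W"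

lemma inj_real_pt: "inj real_pt"
  by (simp add: real_pt_def prod.inj_map inj_on_def)

lemma real_pt_diff: "real_pt a - real_pt b = real_pt (a - b)"
  by (simp add: real_pt_def prod_eq_iff)

lemma orient_real_pt: "orient (real_pt a) (real_pt b) (real_pt c) = of_int (orient a b c)"
  by (simp add: orient_def real_pt_def)

lemma dot_real_pt: "dot (real_pt u) (real_pt v) = of_int (dot u v)"
  by (simp add: dot_def real_pt_def)

lemma same_side_real_pt:
  "same_side (real_pt a) (real_pt b) (real_pt c) (real_pt d) \<longleftrightarrow> same_side a b c d"
  by (simp add: same_side_def orient_real_pt sgn_if)

lemma rac_legs_test_real_pt:
  "rac_legs_test (real_pt a) (real_pt b) (real_pt c) (real_pt d) \<longleftrightarrow> rac_legs_test a b c d"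
  by (simp add: rac_legs_test_def same_side_real_pt orient_real_pt real_pt_diff dot_real_pt
      inj_eq[OF inj_real_pt])

lemma proper_arc_test_real_pt: "proper_arc_test (map_arc real_pt e) \<longleftrightarrow> proper_arc_test e"
  by (cases e) (simp add: orient_real_pt real_pt_diff dot_real_pt)

lemma rac_pair_test_real_pt:
  "rac_pair_test (map_arc real_pt e) (map_arc real_pt f) \<longleftrightarrow> rac_pair_test e f"
  by (cases e; cases f) (simp add: rac_legs_test_real_pt inj_eq[OF inj_real_pt])

lemma vertices_real_arcs: "vertices (real_arcs es) = real_pt ` vertices (set es)"
  by (simp add: real_arcs_def vertices_map_arc)

lemma corners_real_sides: "corners (real_sides W) = real_pt ` set (map fst W)"
  by (simp add: real_sides_def image_image)

lemma card_image_real_pt: "card (real_pt ` A) = card A"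
  using inj_on_subset[OF inj_real_pt subset_UNIV] by (rule card_image)

definition rac_test :: "ipt arc list \<Rightarrow> bool" where
  "rac_test es \<longleftrightarrow> list_all proper_arc_test es \<and> sorted_wrt rac_pair_test es"

lemma rac_test_appendD: "rac_test (es @ fs) \<Longrightarrow> rac_test fs"
  by (simp add: rac_test_def sorted_wrt_append)

lemma rac_test_real_arcs:
  assumes "rac_test es"
  shows "rac_arrangement (real_arcs es)" and "card (real_arcs es) = length es"
proof -
  have "sorted_wrt rac_pair (map (map_arc real_pt) es)"
    unfolding sorted_wrt_map
    by (rule sorted_wrt_mono_rel[of es rac_pair_test])
      (use assms in \<open>simp_all add: rac_test_def rac_pair_if_test rac_pair_test_real_pt\<close>)
  note pairs = sorted_wrt_rac_pair[OF this]
  show "card (real_arcs es) = length es"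
    using distinct_card[OF pairs(1)] by (simp add: real_arcs_def)
  have "proper_arc (map_arc real_pt e)" if "e \<in> set es" for e
    using assms that
    by (intro proper_arc_if_test) (simp add: rac_test_def list_all_iff proper_arc_test_real_pt)
  then show "rac_arrangement (real_arcs es)"
    using pairs(2) by (auto simp: rac_arrangement_def real_arcs_def)
qed

definition leg_inside :: "(ipt \<times> ipt) list \<Rightarrow> ipt \<Rightarrow> ipt \<Rightarrow> bool" where
  "leg_inside W a b \<longleftrightarrow>
     list_all (\<lambda>(p, q). 0 \<le> orient p q a \<and> 0 < orient p q b) W \<and>
     (a \<in> set (map fst W) \<or> list_all (\<lambda>(p, q). 0 < orient p q a) W)"

fun arc_inside :: "(ipt \<times> ipt) list \<Rightarrow> ipt arc \<Rightarrow> bool" where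
  "arc_inside W (a, b, c) \<longleftrightarrow> leg_inside W a b \<and> leg_inside W c b \<and>
     (a \<notin> set (map fst W) \<or> c \<notin> set (map fst W))"

definition leg_outside :: "(ipt \<times> ipt) list \<Rightarrow> ipt \<Rightarrow> ipt \<Rightarrow> bool" where
  "leg_outside W a b \<longleftrightarrow> list_ex (\<lambda>(p, q). orient p q a \<le> 0 \<and> orient p q b \<le> 0) W"

fun arc_outside :: "(ipt \<times> ipt) list \<Rightarrow> ipt arc \<Rightarrow> bool" where
  "arc_outside W (a, b, c) \<longleftrightarrow> leg_outside W a b \<and> leg_outside W c b"

lemma real_pt_in_open_polygon:
  "real_pt a \<in> open_polygon (real_sides W) \<longleftrightarrow> list_all (\<lambda>(p, q). 0 < orient p q a) W"
  by (simp add: open_polygon_def real_sides_def orient_real_pt list_all_iff case_prod_unfold)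

lemma leg_inside_subset:
  assumes "leg_inside W a b"
  shows "closed_segment (real_pt a) (real_pt b) \<subseteq> open_polygon (real_sides W) \<union> corners (real_sides W)"
proof
  fix x assume x_in: "x \<in> closed_segment (real_pt a) (real_pt b)"
  show "x \<in> open_polygon (real_sides W) \<union> corners (real_sides W)"
  proof (cases "x = real_pt a")
    case True
    then show ?thesis
      using assms by (auto simp: leg_inside_def real_pt_in_open_polygon corners_real_sides)
  next
    case False
    have "x \<in> open_polygon (real_sides W)"
    proof (rule closed_segment_into_open_polygon[OF _ _ x_in False])
      show "0 \<le> orient p q (real_pt a)" if "(p, q) \<in> real_sides W" for p q
        using that assms by (auto simp: real_sides_def orient_real_pt leg_inside_def list_all_iff)
      show "real_pt b \<in> open_polygon (real_sides W)"
        using assms by (auto simp: leg_inside_def real_pt_in_open_polygon list_all_iff)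
    qed
    then show ?thesis ..
  qed
qed

lemma leg_outside_disjoint:
  assumes "leg_outside W a b"
  shows "closed_segment (real_pt a) (real_pt b) \<inter> open_polygon (real_sides W) = {}"
proof -
  obtain p q where pq: "(p, q) \<in> set W" "orient p q a \<le> 0" "orient p q b \<le> 0"
    using assms by (auto simp: leg_outside_def list_ex_iff)
  have "x \<notin> open_polygon (real_sides W)" if "x \<in> closed_segment (real_pt a) (real_pt b)" for x
  proof (rule closed_segment_outside_open_polygon[OF _ _ _ that])
    show "(real_pt p, real_pt q) \<in> real_sides W"
      unfolding real_sides_def using pq(1) by (rule map_prod_imageI)
  qed (use pq(2,3) in \<open>simp_all add: orient_real_pt\<close>)
  then show ?thesis by blast
qed

lemma arc_inside_curve:
  assumes "arc_inside W e"
  shows "curve (map_arc real_pt e) \<subseteq> open_polygon (real_sides W) \<union> corners (real_sides W)"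
    and "\<not> ends (map_arc real_pt e) \<subseteq> corners (real_sides W)"
proof -
  obtain a b c where e_eq: "e = (a, b, c)" by (cases e)
  have legs: "leg_inside W a b" "leg_inside W c b" and "\<not> ends e \<subseteq> set (map fst W)"
    using assms unfolding e_eq by simp_all
  then show "\<not> ends (map_arc real_pt e) \<subseteq> corners (real_sides W)"
    unfolding corners_real_sides ends_map_arc inj_image_subset_iff[OF inj_real_pt] by simp
  show "curve (map_arc real_pt e) \<subseteq> open_polygon (real_sides W) \<union> corners (real_sides W)"
    unfolding e_eq map_arc.simps curve_arc using legs by (intro Un_least leg_inside_subset)
qed

lemma arc_outside_curve:
  assumes "arc_outside W e"
  shows "curve (map_arc real_pt e) \<inter> open_polygon (real_sides W) = {}"
proof -
  obtain a b c where e_eq: "e = (a, b, c)" by (cases e)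
  have "leg_outside W a b" "leg_outside W c b" using assms unfolding e_eq by simp_all
  then show ?thesis
    unfolding e_eq map_arc.simps curve_arc Int_Un_distrib2 by (simp add: leg_outside_disjoint)
qed

lemma drawn_inside_real_arcs:
  assumes "rac_test es" "list_all (arc_inside W) es" "set (map fst W) \<subseteq> vertices (set es)"
  shows "drawn_inside (real_sides W) (real_arcs es)"
  unfolding drawn_inside_def
proof (intro conjI)
  show "rac_arrangement (real_arcs es)" using assms(1) by (rule rac_test_real_arcs)
  show "corners (real_sides W) \<subseteq> vertices (real_arcs es)"
    unfolding corners_real_sides vertices_real_arcs using assms(3) by (rule image_mono)
qed (use assms(2) arc_inside_curve in \<open>simp_all add: real_arcs_def list_all_iff\<close>)

lemma drawn_around_real_arcs:
  assumes "rac_test es" "list_all (arc_outside W) es" "set (map fst W) \<subseteq> vertices (set es)"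
  shows "drawn_around (real_sides W) (real_arcs es)"
  unfolding drawn_around_def
proof (intro conjI)
  show "rac_arrangement (real_arcs es)" using assms(1) by (rule rac_test_real_arcs)
  show "corners (real_sides W) \<subseteq> vertices (real_arcs es)"
    unfolding corners_real_sides vertices_real_arcs using assms(3) by (rule image_mono)
qed (use assms(2) arc_outside_curve in \<open>simp_all add: real_arcs_def list_all_iff\<close>)


section \<open>A dodecahedral ring\<close>

text \<open>The sites approximate four regular pentagons, the outer two turned by 36 degrees, with radii in
  the ratio 84 : 202 : 419 : 2520.  The ratio 6 between the outer two is essentially forced by the
  faces with a side on the outermost pentagon; the scale is chosen such that orthogonal legs can meet
  in bends with integer coordinates.\<close>

definition site :: "nat \<Rightarrow> ipt" where
  "site v =
    [(0, 1008), (-960, 312), (-600, -816), (600, -816), (960, 312),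
     (0, 2424), (-2304, 720), (-1428, -1980), (1428, -1980), (2304, 720),
     (-2880, 4008), (-4788, -1596), (0, -5028), (4788, -1596), (2880, 4008),
     (0, -30240), (28800, -9360), (18000, 24480), (-18000, 24480), (-28800, -9360)] ! v"

text \<open>All coordinates of sites are even, so bending a side in its midpoint leaves it straight.\<close>

fun side :: "nat \<times> nat \<Rightarrow> ipt arc" where
  "side (u, v) = (case (site u, site v) of ((x, y), (x', y')) \<Rightarrow>
     ((x, y), ((x + x') div 2, (y + y') div 2), (x', y')))"

text \<open>A face is given by its corners and the bends of the diagonals around them.\<close>

type_synonym face = "nat list \<times> ipt list"

fun diagonals :: "face \<Rightarrow> ipt arc list" where
  "diagonals (vs, bs) =
     map (\<lambda>i. (site (vs ! ((i + 4) mod 5)), bs ! i, site (vs ! ((i + 1) mod 5)))) [0..<5]"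

definition symmetric_faces :: "face list" where
  "symmetric_faces =
    [([3, 2, 7, 12, 8],
        [(180, -1596), (-180, -1596), (-312, -1752), (0, -1844), (312, -1752)]),
     ([17, 18, 10, 5, 14],
        [(216, 6264), (-216, 6264), (-1456, 4944), (0, 5672), (1456, 4944)])]"

definition west_faces :: "face list" where
  "west_faces =
    [([1, 0, 5, 10, 6],
        [(-936, 1080), (-864, 1560), (-720, 1728), (-912, 1560), (-1200, 1224)]),
     ([2, 1, 6, 11, 7],
        [(-1368, -360), (-1524, -255), (-1680, -264), (-1836, -372), (-1572, -780)]),
     ([18, 19, 11, 6, 10],
        [(-5140, 2652), (-6516, 1860), (-6198, 1941), (-3900, 1236), (-4152, 1400)]),
     ([19, 15, 12, 7, 11],
        [(-3900, -5436), (-3519, -5385), (-2562, -4986), (-3340, -3768), (-3840, -3588)])]"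

text \<open>The edge from 0 to 5 is not drawn straight because it would lie on one line with the edge from
  12 to 15, which the criterion for legs does not admit.\<close>

definition ring :: "ipt arc list" where
  "ring = (site 0, (12, 1716), site 5) # map side
     [(0, 1), (1, 2), (2, 3), (3, 4), (4, 0), (1, 6), (2, 7), (3, 8), (4, 9),
      (5, 10), (6, 11), (7, 12), (8, 13), (9, 14), (10, 6), (11, 7), (12, 8), (13, 9), (14, 5),
      (10, 18), (11, 19), (12, 15), (13, 16), (14, 17)] @
     concat (map diagonals (symmetric_faces @ west_faces)) @
     map (map_arc (apfst uminus)) (concat (map diagonals west_faces))"

definition disc :: "ipt arc list" where
  "disc = diagonals ([0, 1, 2, 3, 4],
     [(0, 120), (-180, 108), (-168, -48), (168, -48), (180, 108)]) @ ring"

definition outer_cap :: "ipt arc list" where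
  "outer_cap = map side [(0, 1), (1, 2), (2, 3), (3, 4), (4, 0)] @ diagonals ([3, 2, 1, 0, 4],
     [(4992, -6408), (-4992, -6408), (-6240, 2568), (0, 4152), (6240, 2568)])"

definition inner_sides :: "(ipt \<times> ipt) list" where
  "inner_sides = map (\<lambda>i. (site i, site (Suc i mod 5))) [0..<5]"

definition outer_sides :: "(ipt \<times> ipt) list" where
  "outer_sides = map (\<lambda>i. (site (15 + i), site (15 + Suc i mod 5))) [0..<5]"

abbreviation inner_pentagon :: "(pt \<times> pt) set" where
  "inner_pentagon \<equiv> real_sides inner_sides"

abbreviation outer_pentagon :: "(pt \<times> pt) set" where
  "outer_pentagon \<equiv> real_sides outer_sides"

lemma rac_test_disc: "rac_test disc"
  by code_simp

lemma rac_test_outer_cap: "rac_test outer_cap"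
  by code_simp

lemma arc_inside_disc: "list_all (arc_inside outer_sides) disc"
  by code_simp

lemma arc_outside_ring: "list_all (arc_outside inner_sides) ring"
  by code_simp

lemma arc_outside_outer_cap: "list_all (arc_outside inner_sides) outer_cap"
  by code_simp

lemma length_layers: "length disc = 80" "length ring = 75" "length outer_cap = 10"
  by code_simp+

lemma card_vertices_layers:
  "card (vertices (set disc)) = 20" "card (vertices (set ring)) = 20"
  "card (vertices (set outer_cap)) = 5"
  by code_simp+

lemma card_inner_corners: "card (set (map fst inner_sides)) = 5"
  by code_simp

lemma corners_subset_vertices:
  "set (map fst inner_sides) \<subseteq> vertices (set ring)"
  "set (map fst inner_sides) \<subseteq> vertices (set outer_cap)"
  "set (map fst outer_sides) \<subseteq> vertices (set ring)"
  by code_simp+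

lemma rac_test_ring: "rac_test ring"
  using rac_test_disc unfolding disc_def by (rule rac_test_appendD)

lemma drawn_inside_disc: "drawn_inside outer_pentagon (real_arcs disc)"
proof (rule drawn_inside_real_arcs[OF rac_test_disc arc_inside_disc])
  show "set (map fst outer_sides) \<subseteq> vertices (set disc)"
    using corners_subset_vertices(3) by (auto simp: disc_def vertices_Un)
qed

lemma drawn_inside_ring: "drawn_inside outer_pentagon (real_arcs ring)"
  using rac_test_ring arc_inside_disc corners_subset_vertices(3)
  by (intro drawn_inside_real_arcs) (simp_all add: disc_def)

lemma drawn_around_ring: "drawn_around inner_pentagon (real_arcs ring)"
  using rac_test_ring arc_outside_ring corners_subset_vertices(1) by (rule drawn_around_real_arcs)

lemma drawn_around_outer_cap: "drawn_around inner_pentagon (real_arcs outer_cap)"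
  using rac_test_outer_cap arc_outside_outer_cap corners_subset_vertices(2) by (rule drawn_around_real_arcs)

lemma inner_pentagon_inside_outer:
  "open_polygon inner_pentagon \<union> corners inner_pentagon \<subseteq> open_polygon outer_pentagon"
proof (rule Un_least; rule subsetI)
  note pentagons = open_polygon_def real_sides_def real_pt_def inner_sides_def outer_sides_def
    site_def upt_rec orient_def
  show "z \<in> open_polygon outer_pentagon" if "z \<in> open_polygon inner_pentagon" for z
    using that by (simp add: pentagons)
  show "z \<in> open_polygon outer_pentagon" if "z \<in> corners inner_pentagon" for z
    using that by (auto simp: pentagons)
qed

lemma card_real_arcs_layers:
  "card (real_arcs disc) = 80" "card (real_arcs ring) = 75" "card (real_arcs outer_cap) = 10"
  using rac_test_real_arcs(2) rac_test_disc rac_test_ring rac_test_outer_cap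
  by (simp_all add: length_layers)


section \<open>Nested dodecahedra\<close>

definition shrink :: "pt \<Rightarrow> pt" where
  "shrink = (*\<^sub>R) (- 1 / 30)"

primrec nested_rings :: "nat \<Rightarrow> pt arc set" where
  "nested_rings 0 = map_arc shrink ` real_arcs disc"
| "nested_rings (Suc m) = map_arc shrink ` (nested_rings m \<union> real_arcs ring)"

lemma drawn_inside_shrink:
  assumes "drawn_inside outer_pentagon D"
  shows "drawn_inside inner_pentagon (map_arc shrink ` D)"
proof -
  have "map_prod shrink shrink ` outer_pentagon = inner_pentagon"
    by (simp add: real_sides_def real_pt_def shrink_def inner_sides_def outer_sides_def site_def
        upt_rec)
  then show ?thesis
    using drawn_inside_scaleR[OF _ assms, of "- 1 / 30", folded shrink_def] by simp
qed

lemma drawn_inside_nested_rings: "drawn_inside inner_pentagon (nested_rings m)"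
proof (induction m)
  case 0
  show ?case using drawn_inside_disc by (simp add: drawn_inside_shrink)
next
  case (Suc m)
  have "drawn_inside outer_pentagon (nested_rings m \<union> real_arcs ring)"
    using Suc drawn_around_ring drawn_inside_ring inner_pentagon_inside_outer by (rule drawn_inside_Un)
  then show ?case by (simp add: drawn_inside_shrink)
qed

lemma card_shrink:
  "card (map_arc shrink ` D) = card D" "card (vertices (map_arc shrink ` D)) = card (vertices D)"
proof -
  have "inj shrink" by (simp add: shrink_def injective_scaleR)
  then show "card (map_arc shrink ` D) = card D"
      "card (vertices (map_arc shrink ` D)) = card (vertices D)"
    unfolding vertices_map_arc by (blast intro: card_image inj_map_arc inj_on_subset)+
qed

lemmas card_layers =
  card_real_arcs_layers vertices_real_arcs corners_real_sides card_image_real_pt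
  card_vertices_layers card_inner_corners

lemma card_nested_rings:
  "card (nested_rings m) = 75 * m + 80" "card (vertices (nested_rings m)) = 15 * m + 20"
proof (induction m)
  case 0
  show "card (nested_rings 0) = 75 * 0 + 80" "card (vertices (nested_rings 0)) = 15 * 0 + 20"
    by (simp_all add: card_shrink card_layers)
next
  case (Suc m)
  show "card (nested_rings (Suc m)) = 75 * Suc m + 80"
      "card (vertices (nested_rings (Suc m))) = 15 * Suc m + 20"
    using card_inside_Un_around[OF drawn_inside_nested_rings[of m] drawn_around_ring] Suc
    by (simp_all add: card_shrink card_layers del: set_map)
qed

lemma rac1_graph_nested_dodecahedra: "\<exists>E. rac1_graph (15 * m + 20) E \<and> card E = 75 * m + 90"
proof -
  let ?D = "nested_rings m \<union> real_arcs outer_cap"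
  have "finite ?D" using drawn_inside_nested_rings[of m] by (simp add: drawn_inside_def real_arcs_def)
  moreover have "rac_arrangement ?D"
    using drawn_inside_nested_rings drawn_around_outer_cap by (rule rac_arrangement_inside_Un_around)
  moreover have "card ?D = 75 * m + 90" "card (vertices ?D) = 15 * m + 20"
    using card_inside_Un_around[OF drawn_inside_nested_rings[of m] drawn_around_outer_cap]
    by (simp_all add: card_nested_rings card_layers del: set_map)
  ultimately show ?thesis using rac1_graph_if_rac_arrangement[of ?D] by simp
qed

theorem theorem2:
  shows "infinite {n::nat. n > 0 \<and>
           (\<exists>E. rac1_graph n E \<and> int (card E) = 5 * int n - 10)}"
proof (rule infinite_super)
  show "infinite (range (\<lambda>m::nat. 15 * m + 20))"
    by (rule range_inj_infinite) (simp add: inj_on_def)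
  show "range (\<lambda>m. 15 * m + 20) \<subseteq> {n. n > 0 \<and> (\<exists>E. rac1_graph n E \<and> int (card E) = 5 * int n - 10)}"
  proof (rule image_subsetI)
    fix m :: nat
    obtain E where "rac1_graph (15 * m + 20) E" "card E = 75 * m + 90"
      using rac1_graph_nested_dodecahedra by blast
    then show "15 * m + 20 \<in> {n. n > 0 \<and> (\<exists>E. rac1_graph n E \<and> int (card E) = 5 * int n - 10)}"
      by auto
  qed
qed

end
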